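(* Let $M\in\mathbb{R}^{n\times n}$ be symmetric positive semidefinite, let $1\le k\le n$, and consider the function $$\mathcal{F}(U)=\bigl\|M-MUU^\top\bigr\|_F^2,\qquad U\in\mathbb{R}^{n\times k},\ U^\top U=I_k,$$ viewed as a function on the Grassmann manifold $\mathrm{Gr}(k,n)$. Then $\mathcal{F}$ is geodesically convex on $\mathrm{Gr}(k,n)$ in the sense that every local minimum of $\mathcal{F}$ on $\mathrm{Gr}(k,n)$ is a global minimum, and the global minimum is attained exactly at the subspaces spanned by the top $k$ eigenvectors of $M$.
   Context: $\|\cdot\|_F$ is the Frobenius norm. $\mathrm{Gr}(k,n)$ is the manifold of $k$-dimensional subspaces of $\mathbb{R}^n$; each subspace is represented by a matrix $U\in\mathbb{R}^{n\times k}$ with $U^\top U=I_k$ whose columns form an orthonormal basis of it, and is identified with the rank-$k$ orthogonal projector $P=UU^\top$. The value $\mathcal{F}(U)$ depends only on $UU^\top$, so $\mathcal{F}$ is well defined on $\mathrm{Gr}(k,n)$. "Geodesically convex" is used here only in the sense stated in the claim (every local minimum is global). Eigenvalues of $M$ are ordered $\lambda_1\ge\dots\ge\lambda_n\ge0$; "the top $k$ eigenvectors" means orthonormal eigenvectors associated with $\lambda_1,\dots,\lambda_k$ (with any choice allowed in case of repeated eigenvalues). *)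

theory Defs
  imports "HOL-Analysis.Analysis"
begin

definition stiefel :: "(real^'k^'n) set" where
  "stiefel = {U. transpose U ** U = mat 1}"

definition grassmannian :: "nat \<Rightarrow> (real^'n) set set" where
  "grassmannian k = {S. subspace S \<and> dim S = k}"

definition projector :: "(real^'n) set \<Rightarrow> real^'n^'n" where
  "projector S = (THE P. transpose P = P \<and> P ** P = P \<and> range (\<lambda>x. P *v x) = S)"

text \<open>The topology of the Grassmannian as a submanifold of the space of matrices, each subspace
  being identified with its orthogonal projector.\<close>

definition grassmann_topology :: "nat \<Rightarrow> (real^'n) set topology" where
  "grassmann_topology k = pullback_topology (grassmannian k) projector euclidean"

text \<open>The function on subspaces induced by a function of orthonormal bases; it does not depend on
  the choice of \<open>U\<close> whenever \<open>F U\<close> depends only on \<open>U ** transpose U\<close>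
  (see \<open>on_grassmannian_span\<close> below).\<close>

definition on_grassmannian :: "(real^'k^'n \<Rightarrow> 'a) \<Rightarrow> (real^'n) set \<Rightarrow> 'a" where
  "on_grassmannian F S = F (SOME U. U \<in> stiefel \<and> span (columns U) = S)"

text \<open>The library norm on \<open>real^'m^'n\<close> is the Frobenius norm (see \<open>norm_eq_frobenius\<close> below).\<close>

definition reconstruction_error :: "real^'n^'n \<Rightarrow> real^'k^'n \<Rightarrow> real" where
  "reconstruction_error M U = (norm (M - M ** U ** transpose U))\<^sup>2"

definition is_local_min :: "'a topology \<Rightarrow> ('a \<Rightarrow> real) \<Rightarrow> 'a \<Rightarrow> bool" where
  "is_local_min T f x \<longleftrightarrow>
     x \<in> topspace T \<and> (\<exists>N. openin T N \<and> x \<in> N \<and> (\<forall>y\<in>N. f x \<le> f y))"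

definition is_global_min :: "'a topology \<Rightarrow> ('a \<Rightarrow> real) \<Rightarrow> 'a \<Rightarrow> bool" where
  "is_global_min T f x \<longleftrightarrow> x \<in> topspace T \<and> (\<forall>y\<in>topspace T. f x \<le> f y)"

text \<open>\<open>l 0 \<ge> l 1 \<ge> \<dots>\<close> are the roots of the characteristic polynomial, with multiplicity. Indices
  start at 0 here and below; only the values of \<open>l\<close> at indices below \<open>CARD('n)\<close> matter.\<close>

definition ordered_eigenvalues :: "real^'n^'n \<Rightarrow> (nat \<Rightarrow> real) \<Rightarrow> bool" where
  "ordered_eigenvalues M l \<longleftrightarrow>
     (\<forall>j<CARD('n). \<forall>i\<le>j. l j \<le> l i) \<and>
     (\<forall>x. det (mat x - M) = (\<Prod>i<CARD('n). x - l i))"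

definition top_eigenvectors :: "real^'n^'n \<Rightarrow> nat \<Rightarrow> (nat \<Rightarrow> real^'n) \<Rightarrow> bool" where
  "top_eigenvectors M k v \<longleftrightarrow>
     (\<exists>l. ordered_eigenvalues M l \<and> (\<forall>i<k. M *v v i = l i *\<^sub>R v i)) \<and>
     (\<forall>i<k. \<forall>j<k. v i \<bullet> v j = (if i = j then 1 else 0))"

lemma norm_eq_frobenius:
  fixes A :: "real^'m^'n"
  shows "norm A = sqrt (\<Sum>i\<in>UNIV. \<Sum>j\<in>UNIV. (A$i$j)\<^sup>2)"
  by (simp add: norm_vec_def L2_set_def sum_nonneg)

lemma projector_eqI:
  fixes P :: "real^'n^'n"
  assumes "transpose P = P" "P ** P = P" "range (\<lambda>x. P *v x) = S"
  shows "projector S = P"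
  unfolding projector_def
proof (rule the_equality)
  show "transpose P = P \<and> P ** P = P \<and> range (\<lambda>x. P *v x) = S" using assms by simp
next
  fix Q :: "real^'n^'n"
  assume Q: "transpose Q = Q \<and> Q ** Q = Q \<and> range (\<lambda>x. Q *v x) = S"
  have QP: "Q ** P = P"
  proof -
    have "Q *v (P *v x) = P *v x" for x
    proof -
      from Q assms(3) obtain y where "P *v x = Q *v y" by (metis rangeE rangeI)
      then show ?thesis using Q by (simp add: matrix_vector_mul_assoc)
    qed
    then show ?thesis by (simp add: matrix_eq matrix_vector_mul_assoc)
  qed
  have PQ: "P ** Q = Q"
  proof -
    have "P *v (Q *v x) = Q *v x" for x
    proof -
      from Q assms(3) obtain y where "Q *v x = P *v y" by (metis rangeE rangeI)
      then show ?thesis using assms(2) by (simp add: matrix_vector_mul_assoc)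
    qed
    then show ?thesis by (simp add: matrix_eq matrix_vector_mul_assoc)
  qed
  have "Q = transpose (P ** Q)" using PQ Q by simp
  also have "\<dots> = P" using QP Q assms(1) by (simp add: matrix_transpose_mul)
  finally show "Q = P" .
qed

lemma span_columns_eq_range:
  fixes U :: "real^'k^'n"
  shows "span (columns U) = range (\<lambda>x. U *v x)"
proof
  have "subspace (range (\<lambda>x. U *v x))"
    by (intro linear_subspace_image) auto
  moreover have "columns U \<subseteq> range (\<lambda>x. U *v x)"
    by (auto simp: columns_def matrix_vector_mult_basis [symmetric])
  ultimately show "span (columns U) \<subseteq> range (\<lambda>x. U *v x)"
    by (rule span_minimal [rotated])
  show "range (\<lambda>x. U *v x) \<subseteq> span (columns U)"
    using matrix_vector_mult_in_columnspace by blast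
qed

lemma projector_span_columns:
  fixes U :: "real^'k^'n"
  assumes "U \<in> stiefel"
  shows "projector (span (columns U)) = U ** transpose U"
proof (rule projector_eqI)
  have UU: "transpose U ** U = mat 1" using assms by (simp add: stiefel_def)
  show "transpose (U ** transpose U) = U ** transpose U"
    by (simp add: matrix_transpose_mul)
  show "U ** transpose U ** (U ** transpose U) = U ** transpose U"
    by (metis UU matrix_mul_assoc matrix_mul_rid)
  have "U *v x = (U ** transpose U) *v (U *v x)" for x
    by (metis UU matrix_mul_assoc matrix_mul_rid matrix_vector_mul_assoc)
  then show "range (\<lambda>x. (U ** transpose U) *v x) = span (columns U)"
    unfolding span_columns_eq_range
    by (auto simp: matrix_vector_mul_assoc [symmetric])
qed

lemma span_columns_stiefel_image:
  "(\<lambda>U::real^'k^'n. span (columns U)) ` stiefel = grassmannian CARD('k)"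
proof (intro equalityI subsetI)
  fix S assume "S \<in> (\<lambda>U::real^'k^'n. span (columns U)) ` stiefel"
  then obtain U :: "real^'k^'n" where U: "U \<in> stiefel" and S: "S = span (columns U)" by auto
  have "inj (\<lambda>x. U *v x)"
    using U by (auto simp: stiefel_def matrix_left_invertible_injective [symmetric])
  then have "dim (range (\<lambda>x. U *v x)) = dim (UNIV :: (real^'k) set)"
    by (intro dim_image_eq) auto
  then show "S \<in> grassmannian CARD('k)"
    unfolding S grassmannian_def using subspace_span
    by (simp add: span_columns_eq_range [symmetric])
next
  fix S :: "(real^'n) set" assume "S \<in> grassmannian CARD('k)"
  then have S: "subspace S" "dim S = CARD('k)" by (auto simp: grassmannian_def)
  obtain B where B: "B \<subseteq> S" "pairwise orthogonal B" "\<And>x. x \<in> B \<Longrightarrow> norm x = 1"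
      "independent B" "card B = dim S" "span B = S"
    using orthonormal_basis_subspace [OF S(1)] by metis
  have "finite B" using B(4) by (rule independent_imp_finite)
  then obtain f :: "'k \<Rightarrow> real^'n" where f: "bij_betw f UNIV B"
    using B(5) S(2) by (metis finite finite_same_card_bij)
  define U :: "real^'k^'n" where "U = (\<chi> i j. f j $ i)"
  have col: "column j U = f j" for j by (simp add: U_def column_def vec_eq_iff)
  have "columns U = B"
    using f by (auto simp: columns_def col bij_betw_def)
  moreover have "f i \<bullet> f j = (if i = j then 1 else 0)" for i j
  proof (cases "i = j")
    case True
    then show ?thesis using f B(3) by (metis bij_betwE UNIV_I norm_eq_1)
  next
    case False
    then have "f i \<noteq> f j" using f by (metis UNIV_I bij_betw_def inj_onD)
    then show ?thesis using False f B(2)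
      by (metis UNIV_I bij_betwE orthogonal_def pairwiseD)
  qed
  then have "U \<in> stiefel"
    by (simp add: stiefel_def vec_eq_iff matrix_matrix_mult_def transpose_def U_def mat_def
        inner_vec_def)
  ultimately show "S \<in> (\<lambda>U::real^'k^'n. span (columns U)) ` stiefel"
    using B(6) by auto
qed

lemma on_grassmannian_span:
  fixes F :: "real^'k^'n \<Rightarrow> 'a"
  assumes "\<And>U V. U \<in> stiefel \<Longrightarrow> V \<in> stiefel \<Longrightarrow>
      U ** transpose U = V ** transpose V \<Longrightarrow> F U = F V"
    and "U \<in> stiefel"
  shows "on_grassmannian F (span (columns U)) = F U"
proof -
  let ?V = "SOME V :: real^'k^'n. V \<in> stiefel \<and> span (columns V) = span (columns U)"
  have V: "?V \<in> stiefel \<and> span (columns ?V) = span (columns U)"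
    by (rule someI [where x = U]) (simp add: assms(2))
  then have "?V ** transpose ?V = U ** transpose U"
    using projector_span_columns [of ?V] projector_span_columns [OF assms(2)] by simp
  with V show ?thesis
    unfolding on_grassmannian_def by (intro assms) auto
qed

lemma on_grassmannian_reconstruction_error:
  fixes U :: "real^'k^'n"
  assumes "U \<in> stiefel"
  shows "on_grassmannian (reconstruction_error M :: real^'k^'n \<Rightarrow> real) (span (columns U)) =
    reconstruction_error M U"
  using assms
  by (intro on_grassmannian_span)
    (auto simp: reconstruction_error_def matrix_mul_assoc [symmetric])

lemma topspace_grassmann_topology [simp]:
  "topspace (grassmann_topology k) = grassmannian k"
  by (simp add: grassmann_topology_def topspace_pullback_topology)

end

theory Submission
  imports Defs
begin

text \<open>If \<open>S\<close> is a local minimum, then rotating a unit vector \<open>u\<close> of \<open>S\<close> towards a vector \<open>w\<close> of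
  its orthogonal complement cannot decrease the error, which is
  \<open>(norm M)\<^sup>2\<close> minus the sum of \<open>(norm (M *v d))\<^sup>2\<close> over an orthonormal basis of \<open>S\<close>. To first
  order this gives \<open>(M *v u) \<bullet> (M *v w) = 0\<close>, to second order
  \<open>norm (M *v w) \<le> norm (M *v u) * norm w\<close>. Hence \<open>S\<close> and its complement are invariant under
  \<open>M ** M\<close>, and the eigenvectors of \<open>M ** M\<close> in \<open>S\<close> dominate those in the complement; as \<open>M\<close> is
  positive semidefinite they are eigenvectors of \<open>M\<close>, so \<open>S\<close> is spanned by top eigenvectors.
  Conversely, expanding in an eigenbasis shows that no \<open>k\<close>-dimensional subspace does better than
  one spanned by top eigenvectors (Ky Fan).\<close>

section \<open>Orthonormal sets and symmetric operators\<close>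

definition orthonormal :: "'a::real_inner set \<Rightarrow> bool" where
  "orthonormal B \<longleftrightarrow> pairwise orthogonal B \<and> (\<forall>b\<in>B. norm b = 1)"

lemma orthonormal_inner:
  assumes "orthonormal B" "a \<in> B" "b \<in> B"
  shows "a \<bullet> b = (if a = b then 1 else 0)"
  using assms by (auto simp: orthonormal_def pairwise_def orthogonal_def norm_eq_1)

lemma orthonormal_empty: "orthonormal {}"
  by (simp add: orthonormal_def)

lemma orthonormal_Un:
  assumes "orthonormal B" "orthonormal C" "\<And>b c. b \<in> B \<Longrightarrow> c \<in> C \<Longrightarrow> b \<bullet> c = 0"
  shows "orthonormal (B \<union> C)" "B \<inter> C = {}"
proof -
  show "orthonormal (B \<union> C)"
    using assms by (auto simp: orthonormal_def pairwise_def orthogonal_def) (metis inner_commute)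
  show "B \<inter> C = {}"
    using assms(3) orthonormal_inner [OF assms(1)] by (metis disjoint_iff zero_neq_one)
qed

lemma orthonormal_independent: "orthonormal B \<Longrightarrow> independent B"
  unfolding orthonormal_def by (metis norm_zero pairwise_orthogonal_independent zero_neq_one)

lemma orthonormal_finite:
  fixes B :: "'a::euclidean_space set"
  shows "orthonormal B \<Longrightarrow> finite B"
  by (simp add: independent_imp_finite orthonormal_independent)

lemma orthonormal_card: "orthonormal B \<Longrightarrow> card B = dim (span B)"
  by (simp add: dim_eq_card_independent orthonormal_independent)

lemma orthonormal_expand:
  fixes B :: "'a::euclidean_space set"
  assumes "orthonormal B" "x \<in> span B"
  shows "(\<Sum>b\<in>B. (x \<bullet> b) *\<^sub>R b) = x"
  using assms by (intro orthonormal_basis_expand) (auto simp: orthonormal_def orthonormal_finite)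

lemma orthonormal_parseval:
  fixes B :: "'a::euclidean_space set"
  assumes "orthonormal B" "x \<in> span B"
  shows "(\<Sum>b\<in>B. (x \<bullet> b)\<^sup>2) = (norm x)\<^sup>2"
proof -
  have "(norm x)\<^sup>2 = x \<bullet> (\<Sum>b\<in>B. (x \<bullet> b) *\<^sub>R b)"
    using orthonormal_expand [OF assms] by (simp add: power2_norm_eq_inner)
  then show ?thesis by (simp add: inner_sum_right power2_eq_square)
qed

lemma orthonormal_basis_exists:
  fixes S :: "'a::euclidean_space set"
  assumes "subspace S"
  obtains B where "orthonormal B" "span B = S"
  using orthonormal_basis_subspace [OF assms] unfolding orthonormal_def by metis

lemma orthogonal_comp_span_iff: "x \<in> (span B)\<^sup>\<bottom> \<longleftrightarrow> (\<forall>b\<in>B. b \<bullet> x = 0)"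
proof
  assume *: "\<forall>b\<in>B. b \<bullet> x = 0"
  have "orthogonal x y" if "y \<in> span B" for y
    by (rule orthogonal_to_span [OF that]) (use * in \<open>auto simp: orthogonal_def inner_commute\<close>)
  then show "x \<in> (span B)\<^sup>\<bottom>" by (simp add: orthogonal_comp_def orthogonal_commute)
qed (auto simp: orthogonal_comp_def orthogonal_def span_base)

lemma span_Un_orthogonal_comp:
  assumes "span C = (span B)\<^sup>\<bottom>"
  shows "span (B \<union> C) = (UNIV :: 'a::euclidean_space set)"
proof -
  have "x \<in> span (B \<union> C)" for x :: 'a
  proof -
    have "x \<in> span B + (span B)\<^sup>\<bottom>" by (simp add: subspace_sum_orthogonal_comp)
    then obtain y z where "y \<in> span B" "z \<in> span C" "x = y + z"
      unfolding assms by (rule set_plus_elim)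
    then show ?thesis
      by (meson span_add span_mono subsetD sup_ge1 sup_ge2)
  qed
  then show ?thesis by auto
qed

lemma orthonormal_Un_orthogonal_comp:
  fixes B :: "'a::euclidean_space set"
  assumes "orthonormal B" "orthonormal C" "span C = (span B)\<^sup>\<bottom>"
  shows "orthonormal (B \<union> C)" "B \<inter> C = {}"
proof -
  have "b \<bullet> c = 0" if "b \<in> B" "c \<in> C" for b c
    using that assms(3) span_base [of c C] orthogonal_comp_span_iff [of c B] by auto
  from orthonormal_Un [OF assms(1,2) this] show "orthonormal (B \<union> C)" "B \<inter> C = {}" by auto
qed

text \<open>Completing \<open>B\<close> by an orthonormal basis of the complement turns the sum into
  a partial sum of Parseval's identity with nonnegative terms.\<close>

lemma orthonormal_bessel:
  fixes B :: "'a::euclidean_space set"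
  assumes "orthonormal B"
  shows "(\<Sum>b\<in>B. (x \<bullet> b)\<^sup>2) \<le> (norm x)\<^sup>2"
proof -
  obtain C where C: "orthonormal C" "span C = (span B)\<^sup>\<bottom>"
    using orthonormal_basis_exists subspace_orthogonal_comp by metis
  have "(\<Sum>b\<in>B. (x \<bullet> b)\<^sup>2) \<le> (\<Sum>b\<in>B \<union> C. (x \<bullet> b)\<^sup>2)"
    using assms C by (intro sum_mono2) (auto simp: orthonormal_finite)
  also have "\<dots> = (norm x)\<^sup>2"
    using orthonormal_Un_orthogonal_comp [OF assms C] span_Un_orthogonal_comp [OF C(2)]
    by (intro orthonormal_parseval) auto
  finally show ?thesis .
qed

text \<open>First- and second-order condition for a quadratic that vanishes at 0 and has a local
  maximum there: for small \<open>t\<close> the linear term outweighs the quadratic one, and the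
  sign of \<open>t\<close> is free. It serves both the Rayleigh quotient and the variation of a
  subspace.\<close>

lemma linear_dominated_by_square:
  fixes a b d :: real
  assumes "0 < d" "\<And>t. \<bar>t\<bar> < d \<Longrightarrow> t * a + t\<^sup>2 * b \<le> 0"
  shows "a = 0" "b \<le> 0"
proof -
  show "a = 0"
  proof (rule ccontr)
    assume "a \<noteq> 0"
    \<comment> \<open>Small enough for \<open>s * \<bar>b\<bar> < \<bar>a\<bar>\<close>; the
      \<open>+ 1\<close> guards against \<open>b = 0\<close>.\<close>
    define s where "s = min (d / 2) (\<bar>a\<bar> / (\<bar>b\<bar> + 1))"
    have s: "0 < s" "s < d" using assms(1) \<open>a \<noteq> 0\<close> by (auto simp: s_def)
    have "s * \<bar>b\<bar> < s * (\<bar>b\<bar> + 1)" using s by simp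
    also have "\<dots> \<le> (\<bar>a\<bar> / (\<bar>b\<bar> + 1)) * (\<bar>b\<bar> + 1)"
      by (rule mult_right_mono) (auto simp: s_def)
    also have "\<dots> = \<bar>a\<bar>"
      using abs_ge_zero [of b] by (simp del: abs_ge_zero)
    finally have "\<bar>s * b\<bar> < \<bar>a\<bar>" using s(1) by (simp add: abs_mult)
    then have "0 < \<bar>a\<bar> + s * b" by linarith
    then have "0 < s * (\<bar>a\<bar> + s * b)" using s by simp
    \<comment> \<open>The choice \<open>t = s * sgn a\<close> makes the linear term equal to
      \<open>s * \<bar>a\<bar>\<close>, so the quadratic would be positive at
      \<open>t\<close>.\<close>
    moreover have "\<bar>s * sgn a\<bar> < d" using s \<open>a \<noteq> 0\<close> by (simp add: abs_mult abs_sgn_eq)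
    from assms(2) [OF this] have "s * \<bar>a\<bar> + s\<^sup>2 * b \<le> 0"
      using \<open>a \<noteq> 0\<close> by (simp add: power_mult_distrib abs_sgn [of a] mult_ac)
         (auto simp: sgn_if split: if_splits)
    ultimately show False by (simp add: algebra_simps power2_eq_square)
  qed
  with assms(2) [of "d / 2"] assms(1) show "b \<le> 0"
    by (simp add: mult_le_0_iff)
qed

section \<open>The spectral theorem on an invariant subspace\<close>

lemma orthonormal_insert:
  fixes u :: "'a::euclidean_space"
  assumes T: "subspace T" and u: "u \<in> T" "norm u = 1"
    and B: "orthonormal B" "span B = T \<inter> {u}\<^sup>\<bottom>"
  shows "orthonormal (insert u B)" "u \<notin> B" "span (insert u B) = T"
proof -
  have iff: "x \<in> span B \<longleftrightarrow> x \<in> T \<and> u \<bullet> x = 0" for x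
    by (simp add: B(2) orthogonal_comp_def orthogonal_def)
  have "u \<bullet> b = 0" if "b \<in> B" for b using iff span_base [OF that] by auto
  moreover have "orthonormal {u}" using u(2) by (simp add: orthonormal_def)
  ultimately have "orthonormal ({u} \<union> B)" "{u} \<inter> B = {}"
    using orthonormal_Un [of "{u}" B] B(1) by blast+
  then show "orthonormal (insert u B)" "u \<notin> B" by auto
  show "span (insert u B) = T"
  proof
    show "span (insert u B) \<subseteq> T"
      using u(1) iff span_base T by (intro span_minimal) auto
    show "T \<subseteq> span (insert u B)"
    proof
      fix x assume "x \<in> T"
      then have "x - (u \<bullet> x) *\<^sub>R u \<in> span B"
        using u T unfolding iff
        by (auto simp: inner_diff_right norm_eq_1 intro!: subspace_diff subspace_scale)
      then show "x \<in> span (insert u B)" by (auto simp: span_insert)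
    qed
  qed
qed

text \<open>A maximiser of the Rayleigh quotient on the compact unit sphere of \<open>T\<close> is
  an eigenvector, and the maximum is its eigenvalue.\<close>

lemma symmetric_eigenvector_exists:
  fixes f :: "'a::euclidean_space \<Rightarrow> 'a"
  assumes "linear f" and sym: "\<And>x y. f x \<bullet> y = x \<bullet> f y"
    and T: "subspace T" "f ` T \<subseteq> T" "T \<noteq> {0}"
  obtains u c where "u \<in> T" "norm u = 1" "f u = c *\<^sub>R u"
proof -
  interpret linear f by fact
  let ?K = "T \<inter> sphere 0 1"
  have "compact ?K" by (simp add: closed_Int_compact closed_subspace T(1))
  moreover have "?K \<noteq> {}"
  proof -
    obtain x where "x \<in> T" "x \<noteq> 0" using T subspace_0 by blast
    then have "x /\<^sub>R norm x \<in> ?K" using T(1) by (simp add: subspace_scale)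
    then show ?thesis by blast
  qed
  moreover have "continuous_on ?K (\<lambda>x. x \<bullet> f x)"
    by (intro continuous_intros linear_continuous_on linear_conv_bounded_linear [THEN iffD1] assms)
  ultimately obtain u where u: "u \<in> ?K" and max: "\<And>x. x \<in> ?K \<Longrightarrow> x \<bullet> f x \<le> u \<bullet> f u"
    using continuous_attains_sup by metis
  define c where "c = u \<bullet> f u"
  \<comment> \<open>By homogeneity the bound extends from the sphere to all of \<open>T\<close>, so
    the variation \<open>u + t *\<^sub>R w\<close> below can stay unnormalised.\<close>
  have scaled: "x \<bullet> f x \<le> c * (norm x)\<^sup>2" if "x \<in> T" for x
  proof (cases "x = 0")
    case False
    then have "x /\<^sub>R norm x \<in> ?K" using T(1) that by (simp add: subspace_scale)
    then have "(x /\<^sub>R norm x) \<bullet> f (x /\<^sub>R norm x) \<le> c" using max c_def by blast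
    then show ?thesis using False by (simp add: scale field_simps power2_eq_square)
  qed (simp add: zero)
  have crit: "u \<bullet> f w = 0" if w: "w \<in> T" "u \<bullet> w = 0" for w
  proof -
    have "t * (2 * (u \<bullet> f w)) + t\<^sup>2 * (w \<bullet> f w - c * (norm w)\<^sup>2) \<le> 0" for t
    proof -
      have "u + t *\<^sub>R w \<in> T" using u w T(1) by (auto intro: subspace_add subspace_scale)
      from scaled [OF this]
      have "u \<bullet> f u + 2 * t * (u \<bullet> f w) + t\<^sup>2 * (w \<bullet> f w) \<le> c * (norm (u + t *\<^sub>R w))\<^sup>2"
        using sym [of u w]
        by (simp add: add scale inner_add_left inner_add_right algebra_simps power2_eq_square
            inner_commute)
      also have "(norm (u + t *\<^sub>R w))\<^sup>2 = 1 + t\<^sup>2 * (norm w)\<^sup>2"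
        using u w(2)
        by (auto simp: norm_eq_1 power2_norm_eq_inner inner_add_left inner_add_right inner_commute
            [of w u] power2_eq_square [of t])
      finally show ?thesis by (simp add: c_def algebra_simps)
    qed
    then show ?thesis
      using linear_dominated_by_square(1)
        [of 1 "2 * (u \<bullet> f w)" "w \<bullet> f w - c * (norm w)\<^sup>2"] by simp
  qed
  \<comment> \<open>The residual is itself an admissible direction: invariance puts it in
    \<open>T\<close>, and the value of \<open>c\<close> makes it orthogonal to \<open>u\<close>.
    Applying \<open>crit\<close> to it shows that it is orthogonal to itself.\<close>
  let ?r = "f u - c *\<^sub>R u"
  have r: "?r \<in> T" "u \<bullet> ?r = 0"
    using u T by (auto intro!: subspace_diff subspace_scale simp: inner_diff_right c_def norm_eq_1)
  have "?r \<bullet> ?r = 0"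
    using crit [OF r] r(2) sym [of u ?r] by (simp add: inner_diff_left)
  then have "f u = c *\<^sub>R u" by simp
  then show ?thesis using that u by auto
qed

text \<open>Induction on dimension: split off one eigenvector \<open>u\<close>; symmetry keeps the
  orthogonal complement of \<open>u\<close> in \<open>T\<close> invariant. The relative form with
  \<open>T\<close> carries the induction and is later applied to a subspace and to its complement
  separately.\<close>

lemma symmetric_eigenbasis:
  fixes f :: "'a::euclidean_space \<Rightarrow> 'a"
  assumes lin: "linear f" and sym: "\<And>x y. f x \<bullet> y = x \<bullet> f y"
    and T: "subspace T" "f ` T \<subseteq> T"
  shows "\<exists>B. orthonormal B \<and> span B = T \<and> (\<forall>b\<in>B. \<exists>c. f b = c *\<^sub>R b)"
  using T
proof (induction "dim T" arbitrary: T rule: less_induct)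
  case less
  show ?case
  proof (cases "T = {0}")
    case True
    then show ?thesis by (intro exI [of _ "{}"]) (simp add: orthonormal_empty)
  next
    case False
    obtain u c where u: "u \<in> T" "norm u = 1" "f u = c *\<^sub>R u"
      using symmetric_eigenvector_exists [OF lin sym less.prems False] by metis
    define R where "R = T \<inter> {u}\<^sup>\<bottom>"
    have R_iff: "x \<in> R \<longleftrightarrow> x \<in> T \<and> u \<bullet> x = 0" for x
      by (simp add: R_def orthogonal_comp_def orthogonal_def)
    have subR: "subspace R"
      unfolding R_def by (intro subspace_inter less.prems subspace_orthogonal_comp)
    have "u \<notin> R" using u(2) R_iff by (auto simp: norm_eq_1)
    then have "dim R < dim T"
      using u(1) subR less.prems(1) by (intro dim_psubset) (auto simp: R_def span_eq_iff [THEN iffD2])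
    moreover have "f ` R \<subseteq> R"
    proof clarsimp
      fix x assume x: "x \<in> R"
      have "u \<bullet> f x = f u \<bullet> x" by (simp add: sym)
      then show "f x \<in> R" using x u(3) less.prems(2) by (auto simp: R_iff)
    qed
    ultimately obtain B where B: "orthonormal B" "span B = R" "\<forall>b\<in>B. \<exists>c. f b = c *\<^sub>R b"
      using less.hyps subR by metis
    then show ?thesis
      using orthonormal_insert [OF less.prems(1) u(1,2) B(1)] u(3)
      by (intro exI [of _ "insert u B"]) (auto simp: R_def)
  qed
qed

section \<open>Determinant, Frobenius norm and projectors in orthonormal bases\<close>

lemma orthonormal_basis_bij:
  fixes B :: "(real^'n) set"
  assumes "orthonormal B" "span B = UNIV"
  obtains f :: "'n \<Rightarrow> real^'n" where "bij_betw f UNIV B"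
proof -
  have "card B = CARD('n)" using orthonormal_card [OF assms(1)] assms(2) by simp
  then show ?thesis
    using that orthonormal_finite [OF assms(1)] by (metis finite finite_same_card_bij)
qed

text \<open>The matrix \<open>Q\<close> with the basis vectors as columns conjugates
  \<open>M\<close> to a diagonal matrix, and \<open>det Q\<close> cancels. This connects eigenbases
  with the characteristic polynomial in \<open>ordered_eigenvalues\<close>, multiplicities
  included.\<close>

lemma det_eigenbasis:
  fixes M :: "real^'n^'n"
  assumes B: "orthonormal B" "span B = UNIV" and e: "\<And>b. b \<in> B \<Longrightarrow> M *v b = e b *\<^sub>R b"
  shows "det (mat x - M) = (\<Prod>b\<in>B. x - e b)"
proof -
  obtain f :: "'n \<Rightarrow> real^'n" where f: "bij_betw f UNIV B"
    using orthonormal_basis_bij B by metis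
  define Q :: "real^'n^'n" where "Q = (\<chi> i j. f j $ i)"
  define D :: "real^'n^'n" where "D = (\<chi> i j. if i = j then x - e (f i) else 0)"
  have inB: "f j \<in> B" for j using f by (simp add: bij_betwE)
  have "f i \<bullet> f j = (if i = j then 1 else 0)" for i j
    using orthonormal_inner [OF B(1) inB inB] f by (simp add: bij_betw_def inj_eq)
  then have "transpose Q ** Q = mat 1"
    by (simp add: vec_eq_iff matrix_matrix_mult_def transpose_def Q_def mat_def inner_vec_def)
  then have Q: "det Q \<noteq> 0"
    by (metis det_I det_mul mult_zero_right zero_neq_one)
  have "(mat x - M) ** Q = Q ** D"
  proof -
    have "((mat x - M) ** Q) $ i $ j = (Q ** D) $ i $ j" for i j
    proof -
      have "((mat x - M) ** Q) $ i $ j = ((mat x - M) *v f j) $ i"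
        by (simp add: matrix_matrix_mult_def matrix_vector_mult_def Q_def)
      also have "(mat x - M) *v f j = (x - e (f j)) *\<^sub>R f j"
      proof -
        have "mat x *v f j = x *\<^sub>R f j"
          by (simp add: vec_eq_iff matrix_vector_mult_def mat_def if_distrib
              if_distribR cong: if_cong)
        then show ?thesis
          using e [OF inB] by (simp add: matrix_vector_mult_diff_rdistrib scaleR_diff_left)
      qed
      also have "\<dots> $ i = (Q ** D) $ i $ j"
        by (simp add: matrix_matrix_mult_def Q_def D_def if_distrib cong: if_cong)
      finally show ?thesis .
    qed
    then show ?thesis by (simp add: vec_eq_iff)
  qed
  then have "det (mat x - M) * det Q = det Q * det D" by (metis det_mul)
  then have "det (mat x - M) = det D" using Q by simp
  also have "\<dots> = (\<Prod>i\<in>UNIV. x - e (f i))" by (subst det_diagonal) (auto simp: D_def)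
  also have "\<dots> = (\<Prod>b\<in>B. x - e b)" by (rule prod.reindex_bij_betw [OF f])
  finally show ?thesis .
qed

text \<open>Parseval for each row of \<open>A\<close>, then exchange of the two sums.\<close>

lemma frobenius_orthonormal_basis:
  fixes A :: "real^'n^'m"
  assumes "orthonormal B" "span B = UNIV"
  shows "(norm A)\<^sup>2 = (\<Sum>b\<in>B. (norm (A *v b))\<^sup>2)"
proof -
  have "(norm A)\<^sup>2 = (\<Sum>i\<in>UNIV. (norm (A $ i))\<^sup>2)"
    by (simp add: norm_vec_def [of A] L2_set_def sum_nonneg)
  also have "\<dots> = (\<Sum>i\<in>UNIV. \<Sum>b\<in>B. (A $ i \<bullet> b)\<^sup>2)"
    using assms by (simp add: orthonormal_parseval)
  also have "\<dots> = (\<Sum>b\<in>B. \<Sum>i\<in>UNIV. (A $ i \<bullet> b)\<^sup>2)" by (rule sum.swap)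
  also have "\<dots> = (\<Sum>b\<in>B. (norm (A *v b))\<^sup>2)"
    by (simp add: norm_vec_def [of "A *v _"] L2_set_def sum_nonneg matrix_vector_mul_component)
  finally show ?thesis .
qed

text \<open>With \<open>P\<close> the projector onto \<open>span D\<close>, the matrix
  \<open>M - M ** P\<close> vanishes on \<open>D\<close> and agrees with \<open>M\<close> on the
  complement, so evaluating the Frobenius norm in the basis \<open>D \<union> C\<close> leaves only
  the terms over \<open>C\<close>. Minimising the error thus becomes maximising a sum over
  \<open>D\<close>.\<close>

lemma on_grassmannian_reconstruction_error_basis:
  fixes M :: "real^'n^'n"
  assumes D: "orthonormal D" "card D = CARD('k)"
  shows "on_grassmannian (reconstruction_error M :: real^'k^'n \<Rightarrow> real) (span D) =
    (norm M)\<^sup>2 - (\<Sum>d\<in>D. (norm (M *v d))\<^sup>2)"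
proof -
  have "span D \<in> grassmannian CARD('k)"
    using orthonormal_card [OF D(1)] D(2) by (simp add: grassmannian_def)
  then obtain U :: "real^'k^'n" where U: "U \<in> stiefel" "span D = span (columns U)"
    using span_columns_stiefel_image by blast
  define P where "P = U ** transpose U"
  have UU: "transpose U ** U = mat 1" using U(1) by (simp add: stiefel_def)
  obtain C where C: "orthonormal C" "span C = (span D)\<^sup>\<bottom>"
    using orthonormal_basis_exists subspace_orthogonal_comp by metis
  have P_on_D: "P *v d = d" if d: "d \<in> D" for d
  proof -
    obtain x where "d = U *v x"
      using span_base [OF d] unfolding U(2) span_columns_eq_range by auto
    then show ?thesis
      by (simp add: P_def matrix_vector_mul_assoc) (metis UU matrix_mul_assoc matrix_mul_rid)
  qed
  have P_on_C: "P *v c = 0" if c: "c \<in> C" for c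
  proof -
    have "(transpose U *v c) \<bullet> x = 0" for x
    proof -
      have "U *v x \<in> span D" unfolding U(2) span_columns_eq_range by simp
      moreover have "c \<in> (span D)\<^sup>\<bottom>" using C(2) span_base [OF c] by simp
      ultimately have "c \<bullet> (U *v x) = 0"
        by (simp add: orthogonal_comp_def orthogonal_def inner_commute [of c])
      then show ?thesis
        by (metis dot_lmul_matrix transpose_matrix_vector)
    qed
    then have "transpose U *v c = 0" using inner_eq_zero_iff by blast
    then show ?thesis by (simp add: P_def matrix_vector_mul_assoc [symmetric])
  qed
  note DC = orthonormal_Un_orthogonal_comp [OF D(1) C] span_Un_orthogonal_comp [OF C(2)]
  have fin: "finite D" "finite C" using D C orthonormal_finite by auto
  have split: "(norm A)\<^sup>2 = (\<Sum>d\<in>D. (norm (A *v d))\<^sup>2) + (\<Sum>c\<in>C. (norm (A *v c))\<^sup>2)"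
    for A :: "real^'n^'n"
    using frobenius_orthonormal_basis [OF DC(1,3), of A] sum.union_disjoint [OF fin DC(2)] by simp
  have "reconstruction_error M U = (norm (M - M ** P))\<^sup>2"
    by (simp add: reconstruction_error_def P_def matrix_mul_assoc)
  also have "\<dots> = (\<Sum>c\<in>C. (norm (M *v c))\<^sup>2)"
    by (simp add: split matrix_vector_mult_diff_rdistrib matrix_vector_mul_assoc [symmetric]
        P_on_D P_on_C)
  also have "\<dots> = (norm M)\<^sup>2 - (\<Sum>d\<in>D. (norm (M *v d))\<^sup>2)" by (simp add: split)
  finally show ?thesis
    unfolding U(2) on_grassmannian_reconstruction_error [OF U(1)] .
qed

text \<open>The projector as a sum of rank-one matrices \<open>d d^T\<close>. Since the Grassmann
  topology is pulled back along \<open>projector\<close>, this explicit form makes it possible to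
  check continuity of a curve of subspaces.\<close>

lemma projector_span_orthonormal:
  fixes D :: "(real^'n) set"
  assumes "orthonormal D"
  shows "projector (span D) = (\<Sum>d\<in>D. \<chi> i j. d $ i * d $ j)" (is "_ = ?P")
proof (rule projector_eqI)
  have P: "?P *v x = (\<Sum>d\<in>D. (x \<bullet> d) *\<^sub>R d)" for x
  proof -
    have *: "finite D' \<Longrightarrow> (\<Sum>d\<in>D'. \<chi> i j. d $ i * d $ j) *v x = (\<Sum>d\<in>D'. (x \<bullet> d) *\<^sub>R d)" for D'
    proof (induction rule: finite_induct)
      case (insert d D')
      have "(\<chi> i j. d $ i * d $ j) *v x = (x \<bullet> d) *\<^sub>R d"
        by (simp add: vec_eq_iff matrix_vector_mult_def inner_vec_def sum_distrib_left
            sum_distrib_right mult_ac)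
      with insert show ?case by (simp add: matrix_vector_mult_add_rdistrib)
    qed simp
    then show ?thesis using orthonormal_finite [OF assms] .
  qed
  have in_span: "?P *v x \<in> span D" for x
    unfolding P by (intro span_sum span_scale span_base)
  have fixed: "?P *v x = x" if "x \<in> span D" for x
    unfolding P by (rule orthonormal_expand [OF assms that])
  show "transpose ?P = ?P"
    by (simp add: vec_eq_iff transpose_def mult.commute)
  show "?P ** ?P = ?P"
    by (simp add: matrix_eq matrix_vector_mul_assoc [symmetric] fixed in_span)
  show "range (\<lambda>x. ?P *v x) = span D"
    using in_span fixed by (metis (no_types, lifting) image_subsetI rangeI subsetI subset_antisym)
qed

section \<open>Top eigenvectors\<close>

lemma antimono_enumeration:
  fixes e :: "'a \<Rightarrow> real"
  assumes "finite B"
  obtains v where "bij_betw v {..<card B} B" "\<And>i j. i \<le> j \<Longrightarrow> j < card B \<Longrightarrow> e (v j) \<le> e (v i)"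
proof -
  obtain xs where xs: "set xs = B" "distinct xs" using finite_distinct_list assms by metis
  define ys where "ys = sort_key (\<lambda>b. - e b) xs"
  have ys: "set ys = B" "distinct ys" "sorted (map (\<lambda>b. - e b) ys)"
    using xs by (auto simp: ys_def)
  then have len: "length ys = card B" using distinct_card by metis
  show ?thesis
  proof (rule that [of "(!) ys"])
    show "bij_betw ((!) ys) {..<card B} B"
      using ys len by (intro bij_betw_nth) auto
    show "e (ys ! j) \<le> e (ys ! i)" if "i \<le> j" "j < card B" for i j
      using sorted_nth_mono [OF ys(3) that(1)] that len by simp
  qed
qed

lemma symmetric_matrix_inner:
  fixes M :: "real^'n^'n"
  assumes "transpose M = M"
  shows "(M *v x) \<bullet> y = x \<bullet> (M *v y)"
  by (metis assms dot_lmul_matrix transpose_matrix_vector)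

lemma symmetric_matrix_eigenbasis:
  fixes M :: "real^'n^'n"
  assumes "transpose M = M" "subspace T" "\<And>x. x \<in> T \<Longrightarrow> M *v x \<in> T"
  obtains B where "orthonormal B" "span B = T" "\<And>b. b \<in> B \<Longrightarrow> \<exists>c. M *v b = c *\<^sub>R b"
proof -
  have "\<exists>B. orthonormal B \<and> span B = T \<and> (\<forall>b\<in>B. \<exists>c. M *v b = c *\<^sub>R b)"
    using assms by (intro symmetric_eigenbasis symmetric_matrix_inner) auto
  then show ?thesis using that by blast
qed

text \<open>Put \<open>s = norm (M *v b)\<close>. Then \<open>c\<close> equals \<open>s^2\<close>,
  so (M + s)(M - s) annihilates \<open>b\<close>, and \<open>?y\<close> = (M - s) b would be an
  eigenvector for the eigenvalue -s. For s > 0 positive semidefiniteness forces it to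
  vanish.\<close>

lemma psd_eigenvector_of_square:
  fixes M :: "real^'n^'n"
  assumes sym: "transpose M = M" and psd: "\<forall>x. 0 \<le> x \<bullet> (M *v x)"
    and c: "M *v (M *v b) = c *\<^sub>R b" and b: "norm b = 1"
  shows "M *v b = norm (M *v b) *\<^sub>R b"
proof -
  let ?s = "norm (M *v b)"
  have "?s\<^sup>2 = b \<bullet> (M *v (M *v b))"
    by (simp add: power2_norm_eq_inner symmetric_matrix_inner [OF sym])
  then have s2: "c = ?s\<^sup>2" using b by (simp add: c norm_eq_1)
  show ?thesis
  proof (cases "?s = 0")
    case False
    then have pos: "0 < ?s" by simp
    let ?y = "M *v b - ?s *\<^sub>R b"
    have "M *v ?y = - ?s *\<^sub>R ?y"
      by (simp add: c s2 power2_eq_square matrix_vector_mult_diff_distrib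
          matrix_vector_mult_scaleR algebra_simps)
    then have "0 \<le> - ?s * (?y \<bullet> ?y)" using psd by (metis inner_scaleR_right)
    then have "?y \<bullet> ?y \<le> 0" using pos by (simp add: mult_le_0_iff)
    then show ?thesis by (metis eq_iff_diff_eq_0 inner_eq_zero_iff inner_ge_zero order_antisym)
  qed simp
qed

text \<open>The definition of \<open>top_eigenvectors\<close> refers to the whole ordered spectrum,
  so \<open>C\<close> has to be enumerated too: \<open>B\<close> and \<open>C\<close> are each
  sorted downwards, and \<open>le\<close> keeps the concatenation sorted.\<close>

lemma top_eigenvectors_of_eigenbasis:
  fixes M :: "real^'n^'n"
  assumes BC: "orthonormal (B \<union> C)" "B \<inter> C = {}" "span (B \<union> C) = UNIV"
    and e: "\<And>b. b \<in> B \<union> C \<Longrightarrow> M *v b = e b *\<^sub>R b"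
    and le: "\<And>b c. b \<in> B \<Longrightarrow> c \<in> C \<Longrightarrow> e c \<le> e b"
  obtains v where "top_eigenvectors M (card B) v" "v ` {..<card B} = B"
proof -
  let ?k = "card B" and ?n = "CARD('n)"
  have fin: "finite B" "finite C" using orthonormal_finite [OF BC(1)] by auto
  have n: "?n = ?k + card C"
    using orthonormal_card [OF BC(1)] BC fin by (simp add: card_Un_disjoint)
  obtain v where v: "bij_betw v {..<card B} B"
      "\<And>i j. i \<le> j \<Longrightarrow> j < card B \<Longrightarrow> e (v j) \<le> e (v i)"
    using antimono_enumeration fin(1) by metis
  obtain w where w: "bij_betw w {..<card C} C"
      "\<And>i j. i \<le> j \<Longrightarrow> j < card C \<Longrightarrow> e (w j) \<le> e (w i)"
    using antimono_enumeration fin(2) by metis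
  define V where "V i = (if i < ?k then v i else w (i - ?k))" for i
  define l where "l i = e (V i)" for i
  have "bij_betw V {..<?k} B"
    using v(1) by (subst bij_betw_cong [where g = v]) (auto simp: V_def)
  moreover have "bij_betw V {?k..<?n} C"
  proof -
    have "bij_betw (w \<circ> (\<lambda>i. i - ?k)) {?k..<?n} C"
      by (rule bij_betw_trans [OF _ w(1)])
        (rule bij_betw_byWitness [where f' = "\<lambda>i. i + ?k"], auto simp: n)
    then show ?thesis
      by (subst bij_betw_cong [where g = "w \<circ> (\<lambda>i. i - ?k)"]) (auto simp: V_def)
  qed
  ultimately have V: "bij_betw V {..<?n} (B \<union> C)"
    using bij_betw_combine [OF _ _ BC(2), of V "{..<?k}" "{?k..<?n}"] n
    by (simp add: ivl_disj_un)
  have Vk: "V ` {..<?k} = B" using \<open>bij_betw V {..<?k} B\<close> by (rule bij_betw_imp_surj_on)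
  have inB: "v i \<in> B" if "i < ?k" for i using v(1) that by (auto simp: bij_betw_def)
  have inC: "w i \<in> C" if "i < card C" for i using w(1) that by (auto simp: bij_betw_def)
  have "l j \<le> l i" if "i \<le> j" "j < ?n" for i j
  proof -
    consider "j < ?k" | "i < ?k" "?k \<le> j" | "?k \<le> i" using that by linarith
    then show ?thesis
    proof cases
      case 1
      then show ?thesis using that v(2) by (simp add: l_def V_def)
    next
      case 2
      then show ?thesis using that n le inB inC by (simp add: l_def V_def)
    next
      case 3
      then show ?thesis using that n w(2) by (simp add: l_def V_def)
    qed
  qed
  moreover have "det (mat x - M) = (\<Prod>i<?n. x - l i)" for x
    using det_eigenbasis [OF BC(1,3) e, of x] prod.reindex_bij_betw [OF V, of "\<lambda>b. x - e b"]
    by (simp add: l_def)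
  ultimately have "ordered_eigenvalues M l" by (simp add: ordered_eigenvalues_def)
  moreover have "M *v V i = l i *\<^sub>R V i" if "i < ?k" for i
    using Vk that by (auto simp: l_def intro!: e)
  moreover have "V i \<bullet> V j = (if i = j then 1 else 0)" if "i < ?k" "j < ?k" for i j
  proof -
    have "V i \<in> B" "V j \<in> B" using Vk that by auto
    moreover have "V i = V j \<longleftrightarrow> i = j"
      using \<open>bij_betw V {..<?k} B\<close> that by (auto simp: bij_betw_def inj_on_def)
    ultimately show ?thesis using orthonormal_inner [OF BC(1)] by auto
  qed
  ultimately have "top_eigenvectors M ?k V" by (auto simp: top_eigenvectors_def)
  then show ?thesis using that Vk by blast
qed

text \<open>Pointwise cancellation fails at the roots of \<open>p\<close>; cancellation in the
  integral domain of polynomials does not.\<close>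

lemma linear_factors_cancel:
  fixes p q r :: "real poly"
  assumes "p \<noteq> 0" "\<And>x. poly p x * poly q x = poly p x * poly r x"
  shows "q = r"
proof -
  have "poly (p * q) = poly (p * r)" using assms(2) by (simp add: fun_eq_iff)
  then show ?thesis using assms(1) by (simp add: poly_eq_poly_eq_iff)
qed

text \<open>Converse to \<open>top_eigenvectors_of_eigenbasis\<close>. The complement of
  \<open>span B\<close> is invariant and has an eigenbasis \<open>C\<close>. Comparing two
  factorisations of the characteristic polynomial and cancelling the factors from \<open>B\<close>
  shows that the eigenvalues on \<open>C\<close> are the remaining \<open>l k\<close>, ...,
  \<open>l (n - 1)\<close>.\<close>

lemma top_eigenvectors_eigenbasis:
  fixes M :: "real^'n^'n"
  assumes sym: "transpose M = M" and v: "top_eigenvectors M k v" and k: "0 < k" "k \<le> CARD('n)"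
  defines "B \<equiv> v ` {..<k}"
  obtains C e b0 where "orthonormal B" "card B = k" "orthonormal C" "span C = (span B)\<^sup>\<bottom>"
    "\<And>b. b \<in> B \<union> C \<Longrightarrow> M *v b = e b *\<^sub>R b"
    "b0 \<in> B" "\<And>b. b \<in> B \<Longrightarrow> e b0 \<le> e b" "\<And>c. c \<in> C \<Longrightarrow> e c \<le> e b0"
proof -
  let ?n = "CARD('n)"
  obtain l where l: "\<And>i j. i \<le> j \<Longrightarrow> j < ?n \<Longrightarrow> l j \<le> l i"
      "\<And>x. det (mat x - M) = (\<Prod>i<?n. x - l i)" "\<And>i. i < k \<Longrightarrow> M *v v i = l i *\<^sub>R v i"
    and on: "\<And>i j. i < k \<Longrightarrow> j < k \<Longrightarrow> v i \<bullet> v j = (if i = j then 1 else 0)"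
    using v unfolding top_eigenvectors_def ordered_eigenvalues_def by metis
  have inj: "inj_on v {..<k}"
  proof (rule inj_onI)
    fix i j assume "i \<in> {..<k}" "j \<in> {..<k}" "v i = v j"
    then show "i = j" using on [of i i] on [of i j] by (auto split: if_splits)
  qed
  have B: "orthonormal B" "card B = k"
    using on inj
    by (auto simp: B_def orthonormal_def pairwise_def orthogonal_def norm_eq_1 card_image)
  have "M *v x \<in> (span B)\<^sup>\<bottom>" if "x \<in> (span B)\<^sup>\<bottom>" for x
    using that l(3)
    by (auto simp: orthogonal_comp_span_iff B_def symmetric_matrix_inner [OF sym, symmetric])
  then obtain C where C: "orthonormal C" "span C = (span B)\<^sup>\<bottom>"
      "\<And>b. b \<in> C \<Longrightarrow> \<exists>c. M *v b = c *\<^sub>R b"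
    using symmetric_matrix_eigenbasis [OF sym subspace_orthogonal_comp] by metis
  \<comment> \<open>On a unit eigenvector the Rayleigh quotient is the eigenvalue, which gives one
    function for \<open>B\<close> and \<open>C\<close>.\<close>
  define e where "e b = b \<bullet> (M *v b)" for b
  note BC = orthonormal_Un_orthogonal_comp [OF B(1) C(1,2)] span_Un_orthogonal_comp [OF C(2)]
  have e_of: "e b = c" if "M *v b = c *\<^sub>R b" "b \<in> B \<union> C" for b c
    using that BC(1) by (auto simp: e_def orthonormal_def norm_eq_1)
  have ev: "e (v i) = l i" if "i < k" for i
    using l(3) that by (intro e_of) (auto simp: B_def)
  have eig: "M *v b = e b *\<^sub>R b" if "b \<in> B \<union> C" for b
    using that C(3) e_of l(3) by (auto simp: B_def)
  have finC: "finite C" using C(1) orthonormal_finite by blast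
  let ?p = "\<Prod>i<k. [:- l i, 1:]" and ?q = "\<Prod>c\<in>C. [:- e c, 1:]" and ?r = "\<Prod>i=k..<?n. [:- l i, 1:]"
  have "?q = ?r"
  proof (rule linear_factors_cancel)
    show "?p \<noteq> 0" by (simp add: prod_zero_iff)
    fix x
    have "(\<Prod>i<k. x - l i) * (\<Prod>c\<in>C. x - e c) = (\<Prod>b\<in>B. x - e b) * (\<Prod>c\<in>C. x - e c)"
      using inj ev by (simp add: B_def prod.reindex)
    also have "\<dots> = det (mat x - M)"
      using det_eigenbasis [OF BC(1,3) eig, of x] orthonormal_finite [OF B(1)]
      by (simp add: prod.union_disjoint [OF _ finC BC(2)])
    also have "\<dots> = (\<Prod>i\<in>{..<k} \<union> {k..<?n}. x - l i)"
      using k by (simp add: l(2) ivl_disj_un)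
    also have "\<dots> = (\<Prod>i<k. x - l i) * (\<Prod>i=k..<?n. x - l i)"
      by (rule prod.union_disjoint) auto
    finally show "poly ?p x * poly ?q x = poly ?p x * poly ?r x"
      by (simp add: poly_prod)
  qed
  have le: "e c \<le> l (k - 1)" if c: "c \<in> C" for c
  proof -
    have "poly ?q (e c) = 0" using c finC by (auto simp: poly_prod prod_zero_iff)
    then have "poly ?r (e c) = 0" using \<open>?q = ?r\<close> by simp
    then obtain i where "k \<le> i" "i < ?n" "e c = l i" by (auto simp: poly_prod prod_zero_iff)
    then show ?thesis using l(1) by simp
  qed
  show ?thesis
  proof (rule that [OF B C(1,2) eig])
    \<comment> \<open>Indices start at 0 and eigenvalues decrease along \<open>v\<close>, so the
      smallest one on \<open>B\<close> sits at \<open>k - 1\<close>, an index below \<open>k\<close>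
      because \<open>0 < k\<close>.\<close>
    show "v (k - 1) \<in> B" using k by (auto simp: B_def)
    show "e (v (k - 1)) \<le> e b" if "b \<in> B" for b
      using that k ev l(1) by (auto simp: B_def)
    show "e c \<le> e (v (k - 1))" if "c \<in> C" for c
      using le [OF that] ev k by simp
  qed
qed

text \<open>\<open>w b\<close> is the squared length of the projection of \<open>b\<close> to the competing
  subspace; these weights lie in \<open>[0, 1]\<close> and add up to its dimension.\<close>

lemma eigenbasis_maximal:
  fixes M :: "real^'n^'n"
  assumes sym: "transpose M = M" and psd: "\<forall>x. 0 \<le> x \<bullet> (M *v x)"
    and B: "orthonormal B" and C: "orthonormal C" "span C = (span B)\<^sup>\<bottom>"
    and e: "\<And>b. b \<in> B \<union> C \<Longrightarrow> M *v b = e b *\<^sub>R b"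
    and b0: "b0 \<in> B" "\<And>b. b \<in> B \<Longrightarrow> e b0 \<le> e b" "\<And>c. c \<in> C \<Longrightarrow> e c \<le> e b0"
    and D: "orthonormal D" "card D = card B"
  shows "(\<Sum>d\<in>D. (norm (M *v d))\<^sup>2) \<le> (\<Sum>b\<in>B. (norm (M *v b))\<^sup>2)"
proof -
  note BC = orthonormal_Un_orthogonal_comp [OF B C] span_Un_orthogonal_comp [OF C(2)]
  have fin: "finite B" "finite C" using B C orthonormal_finite by auto
  have norm1: "norm b = 1" if "b \<in> B \<union> C" for b using that BC(1) by (simp add: orthonormal_def)
  \<comment> \<open>Nonnegativity lets the order of the eigenvalues pass to their squares.\<close>
  have e_ge: "0 \<le> e b" if "b \<in> B \<union> C" for b
    using psd [rule_format, of b] e [OF that] norm1 [OF that] by (simp add: norm_eq_1)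
  define w where "w b = (\<Sum>d\<in>D. (b \<bullet> d)\<^sup>2)" for b
  have w_ge: "0 \<le> w b" for b by (simp add: w_def sum_nonneg)
  have w_le: "w b \<le> 1" if "b \<in> B \<union> C" for b
    using orthonormal_bessel [OF D(1), of b] norm1 [OF that] by (simp add: w_def)
  have "(\<Sum>b\<in>B \<union> C. w b) = (\<Sum>d\<in>D. \<Sum>b\<in>B \<union> C. (d \<bullet> b)\<^sup>2)"
    unfolding w_def by (subst sum.swap) (simp add: inner_commute)
  also have "\<dots> = (\<Sum>d\<in>D. (norm d)\<^sup>2)"
    using orthonormal_parseval [OF BC(1)] BC(3) by simp
  also have "\<dots> = real (card B)" using D by (simp add: orthonormal_def)
  finally have sum_w: "(\<Sum>b\<in>B \<union> C. w b) = real (card B)" .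
  have "(\<Sum>d\<in>D. (norm (M *v d))\<^sup>2) = (\<Sum>d\<in>D. \<Sum>b\<in>B \<union> C. ((M *v d) \<bullet> b)\<^sup>2)"
    using orthonormal_parseval [OF BC(1)] BC(3) by simp
  also have "\<dots> = (\<Sum>d\<in>D. \<Sum>b\<in>B \<union> C. (e b)\<^sup>2 * (d \<bullet> b)\<^sup>2)"
    by (intro sum.cong refl)
      (auto simp: symmetric_matrix_inner [OF sym] e power_mult_distrib)
  also have "\<dots> = (\<Sum>b\<in>B \<union> C. (e b)\<^sup>2 * w b)"
    unfolding w_def sum_distrib_left by (subst sum.swap) (simp add: inner_commute)
  finally have sum_D: "(\<Sum>d\<in>D. (norm (M *v d))\<^sup>2) = (\<Sum>b\<in>B \<union> C. (e b)\<^sup>2 * w b)" .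
  \<comment> \<open>This threshold separates the squared eigenvalues on \<open>B\<close> from those
    on \<open>C\<close>. After subtracting \<open>?t\<close> times the total weight, coefficients on
    \<open>B\<close> are nonnegative with weights at most 1, and those on \<open>C\<close> are
    nonpositive.\<close>
  let ?t = "(e b0)\<^sup>2"
  have "(\<Sum>b\<in>B \<union> C. (e b)\<^sup>2 * w b) - ?t * real (card B) = (\<Sum>b\<in>B \<union> C. ((e b)\<^sup>2 - ?t) * w b)"
    by (simp add: sum_w [symmetric] left_diff_distrib sum_subtractf sum_distrib_left)
  also have "\<dots> = (\<Sum>b\<in>B. ((e b)\<^sup>2 - ?t) * w b) + (\<Sum>c\<in>C. ((e c)\<^sup>2 - ?t) * w c)"
    by (rule sum.union_disjoint [OF fin BC(2)])
  also have "\<dots> \<le> (\<Sum>b\<in>B. (e b)\<^sup>2 - ?t) + 0"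
  proof (rule add_mono)
    show "(\<Sum>b\<in>B. ((e b)\<^sup>2 - ?t) * w b) \<le> (\<Sum>b\<in>B. (e b)\<^sup>2 - ?t)"
      using b0 e_ge w_le by (intro sum_mono mult_left_le) (auto intro!: power_mono)
    show "(\<Sum>c\<in>C. ((e c)\<^sup>2 - ?t) * w c) \<le> 0"
      using b0 e_ge w_ge by (intro sum_nonpos mult_nonpos_nonneg) (auto intro!: power_mono)
  qed
  also have "\<dots> = (\<Sum>b\<in>B. (norm (M *v b))\<^sup>2) - ?t * real (card B)"
    by (simp add: sum_subtractf e norm1)
  finally show ?thesis by (simp add: sum_D)
qed

section \<open>Minimisers on the Grassmannian\<close>

text \<open>Extend \<open>u\<close> to an orthonormal basis of \<open>S\<close> and replace only
  \<open>u\<close> by the normalised \<open>u + t *\<^sub>R w\<close>. The other basis vectors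
  contribute equally to both errors, so near \<open>t = 0\<close> local minimality compares just
  \<open>M *v y t\<close> with \<open>M *v u\<close>.\<close>

lemma local_min_first_second_order:
  fixes M :: "real^'n^'n"
  assumes min: "is_local_min (grassmann_topology CARD('k))
      (on_grassmannian (reconstruction_error M :: real^'k^'n \<Rightarrow> real)) S"
    and u: "u \<in> S" "norm u = 1" and w: "w \<in> S\<^sup>\<bottom>"
  shows "(M *v u) \<bullet> (M *v w) = 0" "norm (M *v w) \<le> norm (M *v u) * norm w"
proof -
  let ?F = "on_grassmannian (reconstruction_error M :: real^'k^'n \<Rightarrow> real)"
  obtain N where S: "subspace S" "dim S = CARD('k)"
    and N: "openin (grassmann_topology CARD('k)) N" "S \<in> N" "\<And>S'. S' \<in> N \<Longrightarrow> ?F S \<le> ?F S'"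
    using min by (auto simp: is_local_min_def grassmannian_def)
  obtain W where W: "open W" "N = projector -` W \<inter> grassmannian CARD('k)"
    using N(1) by (auto simp: grassmann_topology_def openin_pullback_topology)
  obtain B where B: "orthonormal B" "span B = S \<inter> {u}\<^sup>\<bottom>"
    using orthonormal_basis_exists [OF subspace_inter [OF S(1) subspace_orthogonal_comp]] by metis
  note uB = orthonormal_insert [OF S(1) u B]
  have finB: "finite B" using B(1) orthonormal_finite by blast
  have cardB: "card (insert u B) = CARD('k)" using orthonormal_card [OF uB(1)] uB(3) S(2) by simp
  have wS: "x \<bullet> w = 0" if "x \<in> S" for x
    using w that by (simp add: orthogonal_comp_def orthogonal_def)
  have r: "0 < 1 + t\<^sup>2 * (norm w)\<^sup>2" for t :: real
    by (simp add: add_pos_nonneg)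
  define y where "y t = (u + t *\<^sub>R w) /\<^sub>R sqrt (1 + t\<^sup>2 * (norm w)\<^sup>2)" for t
  have norm_ut: "(norm (u + t *\<^sub>R w))\<^sup>2 = 1 + t\<^sup>2 * (norm w)\<^sup>2" for t
    using u wS [OF u(1)]
    by (auto simp: norm_eq_1 power2_norm_eq_inner inner_add_left inner_add_right
        inner_commute [of w u] power2_eq_square [of t])
  have norm_y: "norm (y t) = 1" for t
  proof -
    have "norm (u + t *\<^sub>R w) = sqrt (1 + t\<^sup>2 * (norm w)\<^sup>2)"
      by (metis norm_ut norm_ge_zero real_sqrt_unique)
    then show ?thesis using r [of t] by (simp add: y_def)
  qed
  have orth_y: "y t \<bullet> b = 0" if "b \<in> B" for t b
  proof -
    have "b \<in> S" "u \<bullet> b = 0"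
      using span_base [OF that] B(2) by (auto simp: orthogonal_comp_def orthogonal_def)
    then show ?thesis using wS by (simp add: y_def inner_add_left inner_commute [of w])
  qed
  have yB: "orthonormal (insert (y t) B)" "y t \<notin> B" for t
    using orthonormal_Un [of "{y t}" B] B(1) orth_y norm_y by (auto simp: orthonormal_def)
  have card_yB: "card (insert (y t) B) = CARD('k)" for t
    using cardB yB(2) uB(2) finB by simp
  \<comment> \<open>The projector of the varied subspace as an explicit continuous function of
    \<open>t\<close>; at \<open>t = 0\<close> it is the projector of \<open>S\<close>, so it stays
    in \<open>W\<close> for small \<open>t\<close>.\<close>
  define P where "P t = (\<chi> i j. y t $ i * y t $ j) + (\<Sum>b\<in>B. \<chi> i j. b $ i * b $ j)" for t
  have P: "projector (span (insert (y t) B)) = P t" for t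
    using projector_span_orthonormal [OF yB(1)] finB yB(2) by (simp add: P_def)
  have "continuous_on UNIV y"
    unfolding y_def using r by (intro continuous_intros) (auto simp: less_imp_neq [THEN not_sym])
  then have "continuous_on UNIV P"
    unfolding P_def by (intro continuous_intros)
  then have "open (P -` W)" using W(1) by (simp add: open_vimage)
  moreover have "0 \<in> P -` W"
    using P [of 0] N(2) W(2) uB(3) by (simp add: y_def)
  ultimately obtain d where d: "0 < d" "\<And>t. \<bar>t\<bar> < d \<Longrightarrow> P t \<in> W"
    unfolding open_dist by (force simp: dist_norm)
  have "t * (2 * ((M *v u) \<bullet> (M *v w))) +
      t\<^sup>2 * ((norm (M *v w))\<^sup>2 - (norm (M *v u) * norm w)\<^sup>2) \<le> 0" if t: "\<bar>t\<bar> < d" for t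
  proof -
    have "span (insert (y t) B) \<in> grassmannian CARD('k)"
      using orthonormal_card [OF yB(1)] card_yB by (simp add: grassmannian_def)
    then have "?F S \<le> ?F (span (insert (y t) B))"
      using N(3) W(2) P d(2) [OF t] by auto
    then have "(norm (M *v y t))\<^sup>2 \<le> (norm (M *v u))\<^sup>2"
      using on_grassmannian_reconstruction_error_basis [OF uB(1) cardB, of M]
        on_grassmannian_reconstruction_error_basis [OF yB(1) card_yB, of M] uB(2,3) yB(2) finB
      by simp
    moreover have "(norm (M *v y t))\<^sup>2 = (norm (M *v (u + t *\<^sub>R w)))\<^sup>2 / (1 + t\<^sup>2 * (norm w)\<^sup>2)"
      using r [of t] by (simp add: y_def matrix_vector_mult_scaleR power_divide divide_inverse
          power_mult_distrib power_inverse mult.commute)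
    \<comment> \<open>Clearing the normalising denominator leaves a quadratic inequality in
      \<open>t\<close> whose constant terms cancel.\<close>
    ultimately have
      "(norm (M *v (u + t *\<^sub>R w)))\<^sup>2 \<le> (norm (M *v u))\<^sup>2 * (1 + t\<^sup>2 * (norm w)\<^sup>2)"
      using r [of t] by (simp add: pos_divide_le_eq)
    moreover have "(norm (M *v (u + t *\<^sub>R w)))\<^sup>2 =
        (norm (M *v u))\<^sup>2 + 2 * t * ((M *v u) \<bullet> (M *v w)) + t\<^sup>2 * (norm (M *v w))\<^sup>2"
      by (simp add: power2_norm_eq_inner matrix_vector_right_distrib matrix_vector_mult_scaleR
          inner_add_left inner_add_right inner_commute [of "M *v w" "M *v u"] power2_eq_square [of t]
          algebra_simps)
    ultimately show ?thesis by (simp add: algebra_simps power_mult_distrib)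
  qed
  from linear_dominated_by_square [OF d(1) this]
  show "(M *v u) \<bullet> (M *v w) = 0" "norm (M *v w) \<le> norm (M *v u) * norm w"
    by (auto simp: power2_le_iff_abs_le)
qed

text \<open>The first-order condition pairs \<open>M *v u\<close> with \<open>M *v w\<close>, hence
  gives invariance under \<open>M ** M\<close> rather than under \<open>M\<close>. Eigenvectors of
  the square are turned into eigenvectors of \<open>M\<close> by
  \<open>psd_eigenvector_of_square\<close>; the second-order condition then orders the
  eigenvalues.\<close>

lemma local_min_imp_top_eigenvectors:
  fixes M :: "real^'n^'n"
  assumes sym: "transpose M = M" and psd: "\<forall>x. 0 \<le> x \<bullet> (M *v x)"
    and min: "is_local_min (grassmann_topology CARD('k))
      (on_grassmannian (reconstruction_error M :: real^'k^'n \<Rightarrow> real)) S"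
  obtains v where "top_eigenvectors M CARD('k) v" "S = span (v ` {..<CARD('k)})"
proof -
  have S: "subspace S" "dim S = CARD('k)"
    using min by (auto simp: is_local_min_def grassmannian_def)
  have crit: "(M *v u) \<bullet> (M *v w) = 0" if "u \<in> S" "w \<in> S\<^sup>\<bottom>" for u w
  proof (cases "u = 0")
    case False
    have "u /\<^sub>R norm u \<in> S" "norm (u /\<^sub>R norm u) = 1"
      using that S(1) False by (auto simp: subspace_scale)
    from local_min_first_second_order(1) [OF min this that(2)] show ?thesis
      using False by (simp add: matrix_vector_mult_scaleR)
  qed simp
  have symMM: "transpose (M ** M) = M ** M" by (simp add: matrix_transpose_mul sym)
  have MM: "(M ** M) *v x = M *v (M *v x)" for x by (simp add: matrix_vector_mul_assoc)
  \<comment> \<open>Orthogonality to the complement is what \<open>crit\<close> yields; membership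
    in \<open>S\<close> follows because a subspace equals its double complement.\<close>
  have "(M ** M) *v x \<in> S\<^sup>\<bottom>\<^sup>\<bottom>" if "x \<in> S" for x
  proof -
    have "y \<bullet> (M *v (M *v x)) = (M *v x) \<bullet> (M *v y)" for y
      by (metis inner_commute symmetric_matrix_inner [OF sym])
    then show ?thesis
      unfolding orthogonal_comp_def [of "S\<^sup>\<bottom>"] using crit [OF that] by (simp add: orthogonal_def MM)
  qed
  then have invS: "(M ** M) *v x \<in> S" if "x \<in> S" for x
    using that orthogonal_comp_self [OF S(1)] by simp
  have invC: "(M ** M) *v x \<in> S\<^sup>\<bottom>" if "x \<in> S\<^sup>\<bottom>" for x
    using that crit [OF _ that]
    by (auto simp: orthogonal_comp_def orthogonal_def MM symmetric_matrix_inner [OF sym, symmetric])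
  obtain B where B: "orthonormal B" "span B = S" "\<And>b. b \<in> B \<Longrightarrow> \<exists>c. (M ** M) *v b = c *\<^sub>R b"
    using symmetric_matrix_eigenbasis [OF symMM S(1) invS] by metis
  obtain C where C: "orthonormal C" "span C = S\<^sup>\<bottom>" "\<And>b. b \<in> C \<Longrightarrow> \<exists>c. (M ** M) *v b = c *\<^sub>R b"
    using symmetric_matrix_eigenbasis [OF symMM subspace_orthogonal_comp invC] by metis
  have C': "span C = (span B)\<^sup>\<bottom>" using B(2) C(2) by simp
  note BC = orthonormal_Un_orthogonal_comp [OF B(1) C(1) C'] span_Un_orthogonal_comp [OF C']
  have norm1: "norm b = 1" if "b \<in> B \<union> C" for b using that BC(1) by (simp add: orthonormal_def)
  \<comment> \<open>The eigenvalue is written as \<open>norm (M *v b)\<close>, the quantity that the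
    second-order condition compares.\<close>
  have eig: "M *v b = norm (M *v b) *\<^sub>R b" if "b \<in> B \<union> C" for b
    using that B(3) C(3) norm1 [OF that] psd_eigenvector_of_square [OF sym psd]
    unfolding MM by blast
  have le: "norm (M *v c) \<le> norm (M *v b)" if "b \<in> B" "c \<in> C" for b c
    using local_min_first_second_order(2) [OF min, of b c] that norm1 B(2) C(2) span_base
    by (metis UnCI mult.right_neutral)
  obtain v where "top_eigenvectors M (card B) v" "v ` {..<card B} = B"
    using top_eigenvectors_of_eigenbasis [OF BC(1,2,3) eig le] by metis
  moreover have "card B = CARD('k)" using orthonormal_card [OF B(1)] B(2) S(2) by simp
  ultimately show ?thesis using that B(2) by metis
qed

lemma top_eigenvectors_imp_global_min:
  fixes M :: "real^'n^'n"
  assumes sym: "transpose M = M" and psd: "\<forall>x. 0 \<le> x \<bullet> (M *v x)"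
    and k: "CARD('k) \<le> CARD('n)" and v: "top_eigenvectors M CARD('k) v"
  shows "is_global_min (grassmann_topology CARD('k))
    (on_grassmannian (reconstruction_error M :: real^'k^'n \<Rightarrow> real)) (span (v ` {..<CARD('k)}))"
proof -
  let ?B = "v ` {..<CARD('k)}"
  obtain C e b0 where B: "orthonormal ?B" "card ?B = CARD('k)"
    and C: "orthonormal C" "span C = (span ?B)\<^sup>\<bottom>" "\<And>b. b \<in> ?B \<union> C \<Longrightarrow> M *v b = e b *\<^sub>R b"
      "b0 \<in> ?B" "\<And>b. b \<in> ?B \<Longrightarrow> e b0 \<le> e b" "\<And>c. c \<in> C \<Longrightarrow> e c \<le> e b0"
    using top_eigenvectors_eigenbasis [OF sym v zero_less_card_finite k] by metis
  have "span ?B \<in> grassmannian CARD('k)"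
    using orthonormal_card [OF B(1)] B(2) by (simp add: grassmannian_def)
  moreover have "on_grassmannian (reconstruction_error M :: real^'k^'n \<Rightarrow> real) (span ?B)
      \<le> on_grassmannian (reconstruction_error M :: real^'k^'n \<Rightarrow> real) S"
    if S: "S \<in> grassmannian CARD('k)" for S
  proof -
    obtain D where D: "orthonormal D" "span D = S"
      using S orthonormal_basis_exists by (auto simp: grassmannian_def)
    then have card: "card D = CARD('k)"
      using orthonormal_card [OF D(1)] S by (simp add: grassmannian_def)
    have "(\<Sum>d\<in>D. (norm (M *v d))\<^sup>2) \<le> (\<Sum>b\<in>?B. (norm (M *v b))\<^sup>2)"
      using D(1) card B(2) by (intro eigenbasis_maximal [OF sym psd B(1) C]) auto
    then show ?thesis
      using on_grassmannian_reconstruction_error_basis [OF B, of M]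
        on_grassmannian_reconstruction_error_basis [OF D(1) card, of M] D(2) by simp
  qed
  ultimately show ?thesis by (simp add: is_global_min_def)
qed

text \<open>Sort a full eigenbasis by decreasing eigenvalue and cut it after \<open>k\<close>
  vectors. This supplies the existence of a minimiser.\<close>

lemma top_eigenvectors_exist:
  fixes M :: "real^'n^'n"
  assumes sym: "transpose M = M" and k: "k \<le> CARD('n)"
  obtains v where "top_eigenvectors M k v"
proof -
  obtain E where E: "orthonormal E" "span E = UNIV" "\<And>b. b \<in> E \<Longrightarrow> \<exists>c. M *v b = c *\<^sub>R b"
    using symmetric_matrix_eigenbasis [OF sym subspace_UNIV] by blast
  then obtain e where e: "\<And>b. b \<in> E \<Longrightarrow> M *v b = e b *\<^sub>R b" by metis
  have card: "card E = CARD('n)" using orthonormal_card [OF E(1)] E(2) by simp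
  obtain v where v: "bij_betw v {..<card E} E" "\<And>i j. i \<le> j \<Longrightarrow> j < card E \<Longrightarrow> e (v j) \<le> e (v i)"
    using antimono_enumeration orthonormal_finite [OF E(1)] by metis
  let ?B = "v ` {..<k}" and ?C = "v ` {k..<card E}"
  have un: "?B \<union> ?C = E"
    using v(1) k card by (simp add: image_Un [symmetric] ivl_disj_un bij_betw_def)
  have inj: "inj_on v {..<card E}" using v(1) by (simp add: bij_betw_def)
  have disj: "?B \<inter> ?C = {}"
  proof -
    have "{..<k} \<subseteq> {..<card E}" "{k..<card E} \<subseteq> {..<card E}" "{..<k} \<inter> {k..<card E} = {}"
      using k card by auto
    then show ?thesis using inj_on_image_Int [OF inj] by (metis image_empty)
  qed
  have "card ?B = k"
    using inj k card by (subst card_image) (auto intro: inj_on_subset)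
  moreover have "e c \<le> e b" if "b \<in> ?B" "c \<in> ?C" for b c
    using that v(2) by auto
  ultimately show ?thesis
    using top_eigenvectors_of_eigenbasis [of ?B ?C M e] E e disj that unfolding un by metis
qed

theorem theorem3p5:
  fixes M :: "real^'n^'n"
  assumes symmetric: "transpose M = M"
    and psd: "\<forall>x. 0 \<le> x \<bullet> (M *v x)"
    and k_le_n: "CARD('k) \<le> CARD('n)"
  shows "let Gr = grassmann_topology CARD('k);
             F = on_grassmannian (reconstruction_error M :: real^'k^'n \<Rightarrow> real)
         in (\<forall>S. is_local_min Gr F S \<longrightarrow> is_global_min Gr F S) \<and>
            (\<exists>S. is_global_min Gr F S) \<and>
            {S. is_global_min Gr F S} =
              {span (v ` {..<CARD('k)}) | v. top_eigenvectors M CARD('k) v}"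
proof -
  let ?Gr = "grassmann_topology CARD('k) :: (real^'n) set topology"
  let ?F = "on_grassmannian (reconstruction_error M :: real^'k^'n \<Rightarrow> real)"
  have top: "\<exists>v. top_eigenvectors M CARD('k) v \<and> S = span (v ` {..<CARD('k)})"
    if "is_local_min ?Gr ?F S" for S
    using local_min_imp_top_eigenvectors [OF symmetric psd that] by blast
  have global: "is_global_min ?Gr ?F (span (v ` {..<CARD('k)}))"
    if "top_eigenvectors M CARD('k) v" for v
    using top_eigenvectors_imp_global_min [OF symmetric psd k_le_n that] .
  \<comment> \<open>The whole space serves as the neighbourhood. This closes the cycle: global
    minimum, local minimum, span of top eigenvectors, global minimum.\<close>
  have "is_local_min ?Gr ?F S" if "is_global_min ?Gr ?F S" for S
    using that openin_topspace [of ?Gr] unfolding is_local_min_def is_global_min_def by blast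
  moreover have "\<exists>v. top_eigenvectors M CARD('k) v"
    using top_eigenvectors_exist [OF symmetric k_le_n] by blast
  ultimately show ?thesis
    unfolding Let_def using top global by blast
qed

end
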